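(* Let $(T,v),(T',w)$ be geodesically complete rooted $\mathbb{R}$-trees and let $f:end(T,v)\to end(T',w)$ be a uniformly continuous map between their end spaces. Then the induced map $\hat f:T\to T'$ is metrically proper between trees, i.e. $\hat f$ is continuous, $\hat f(v)=w$, and $\hat f^{-1}(A)$ is bounded in $T$ for every bounded set $A\subset T'$.
   Context: An $\mathbb{R}$-tree is a metric space $(T,d)$ that is uniquely arcwise connected and such that for all $x,y\in T$ the unique arc from $x$ to $y$ is isometric to $[0,d(x,y)]\subset\mathbb{R}$. A rooted $\mathbb{R}$-tree $(T,v)$ is an $\mathbb{R}$-tree with a chosen point $v$ (the root). It is geodesically complete if every isometric embedding $g:[0,t]\to T$, $t>0$, with $g(0)=v$ extends to an isometric embedding $[0,\infty)\to T$. The end space is $end(T,v)=\{F:[0,\infty)\to T \mid F \text{ is an isometric embedding}, F(0)=v\}$ with the ultrametric $d_e(F,G)=0$ if $F=G$, and $d_e(F,G)=e^{-t_0}$ with $t_0=\sup\{t\ge 0: F(t)=G(t)\}$ if $F\neq G$; it has diameter $\le 1$. Construction of $\lambda$ from $f$: put $\varrho(\delta)=\sup\{d_e(f(F),f(G)) : d_e(F,G)\le\delta\}$ for $\delta\ge0$. For a function $\varrho$ and $x_1<x_2$, $x=tx_1+(1-t)x_2$ with $t\in[0,1]$, let $\varrho_{x_1,x_2}(x)=t\varrho(x_1)+(1-t)\varrho(x_2)$, and let $\omega(x)=\sup\{\varrho_{x_1,x_2}(x) : 0\le x_1<x_2,\ x\in[x_1,x_2]\}$. If $\omega(1)=1$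 put $\lambda=\omega|_{[0,1]}$. If $\omega(1)<1$, let $\varrho'(t)=\omega(t)$ for $t\in[0,1)$, $\varrho'(1)=1$, and let $\lambda(x)=\sup\{\varrho'_{x_1,x_2}(x): 0\le x_1<x_2\le 1,\ x\in[x_1,x_2]\}$ for $x\in[0,1]$. Then $\lambda:[0,1]\to[0,1]$ is continuous, concave, non-decreasing, $\lambda(0)=0$, $\lambda(1)=1$, and $d_e(f(F),f(G))\le\lambda(d_e(F,G))$ for all $F,G\in end(T,v)$. Definition of $\hat f$: for $x\in T$ let $F\in end(T,v)$ and $t\in[0,\infty)$ with $x=F(t)$ (necessarily $t=d(v,x)$), and put $\hat f(x)=f(F)\big(-\ln(\lambda(e^{-t}))\big)$. This does not depend on the choice of $F$. *)

theory Defs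
  imports "HOL-Analysis.Analysis"
begin

text \<open>
  A metric space \<open>(T, d)\<close> is a set \<open>T\<close> in a type of class \<^class>\<open>metric_space\<close>, with the
  restricted distance and the subspace topology.
\<close>

definition isometric_embedding_on ::
    "'a::metric_space set \<Rightarrow> 'b::metric_space set \<Rightarrow> ('a \<Rightarrow> 'b) \<Rightarrow> bool" where
  "isometric_embedding_on S T g \<longleftrightarrow>
     g \<in> S \<rightarrow> T \<and> (\<forall>x\<in>S. \<forall>y\<in>S. dist (g x) (g y) = dist x y)"

text \<open>Arcs are identified with their images, so that uniqueness is not spoilt by reparametrisation.\<close>

definition arc_between :: "'a::metric_space set \<Rightarrow> 'a \<Rightarrow> 'a \<Rightarrow> 'a set \<Rightarrow> bool" where
  "arc_between T x y A \<longleftrightarrow>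
     A \<subseteq> T \<and> (\<exists>g. arc g \<and> pathstart g = x \<and> pathfinish g = y \<and> path_image g = A)"

definition uniquely_arcwise_connected :: "'a::metric_space set \<Rightarrow> bool" where
  "uniquely_arcwise_connected T \<longleftrightarrow>
     (\<forall>x\<in>T. \<forall>y\<in>T. x \<noteq> y \<longrightarrow> (\<exists>!A. arc_between T x y A))"

definition R_tree :: "'a::metric_space set \<Rightarrow> bool" where
  "R_tree T \<longleftrightarrow> uniquely_arcwise_connected T \<and>
     (\<forall>x\<in>T. \<forall>y\<in>T. \<forall>A. arc_between T x y A \<longrightarrow>
        (\<exists>h. isometric_embedding_on {0..dist x y} A h \<and> h ` {0..dist x y} = A))"

definition rooted_R_tree :: "'a::metric_space set \<Rightarrow> 'a \<Rightarrow> bool" where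
  "rooted_R_tree T v \<longleftrightarrow> R_tree T \<and> v \<in> T"

definition geodesically_complete :: "'a::metric_space set \<Rightarrow> 'a \<Rightarrow> bool" where
  "geodesically_complete T v \<longleftrightarrow>
     (\<forall>t>0. \<forall>g::real \<Rightarrow> 'a. isometric_embedding_on {0..t} T g \<and> g 0 = v \<longrightarrow>
        (\<exists>F. isometric_embedding_on {0..} T F \<and> (\<forall>s\<in>{0..t}. F s = g s)))"

text \<open>
  Maps \<open>[0,\<infinity>) \<rightarrow> T\<close> are extensional functions on \<open>{0..}\<close>, so that equality of functions is
  equality on \<open>[0,\<infinity>)\<close>.
\<close>

definition end_space :: "'a::metric_space set \<Rightarrow> 'a \<Rightarrow> (real \<Rightarrow> 'a) set" where
  "end_space T v = {F \<in> extensional {0..}. isometric_embedding_on {0..} T F \<and> F 0 = v}"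

definition end_dist :: "(real \<Rightarrow> 'a) \<Rightarrow> (real \<Rightarrow> 'a) \<Rightarrow> real" where
  "end_dist F G = (if F = G then 0 else exp (- Sup {t. 0 \<le> t \<and> F t = G t}))"

text \<open>
  \<^const>\<open>metric\<close> yields the intended metric only for an actual metric; this is the content of the
  lemma \<open>Metric_space_end_space\<close> below.
\<close>

definition end_metric :: "'a::metric_space set \<Rightarrow> 'a \<Rightarrow> (real \<Rightarrow> 'a) metric" where
  "end_metric T v = metric (end_space T v, end_dist)"

definition oscillation ::
    "'a::metric_space set \<Rightarrow> 'a \<Rightarrow> ((real \<Rightarrow> 'a) \<Rightarrow> (real \<Rightarrow> 'b)) \<Rightarrow> real \<Rightarrow> real" where
  "oscillation T v f \<delta> = Sup {end_dist (f F) (f G) | F G.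
     F \<in> end_space T v \<and> G \<in> end_space T v \<and> end_dist F G \<le> \<delta>}"

text \<open>Supremum at \<open>x\<close> of the chords of the graph of \<open>r\<close> with end points over \<open>D\<close>.\<close>

definition chord_sup :: "real set \<Rightarrow> (real \<Rightarrow> real) \<Rightarrow> real \<Rightarrow> real" where
  "chord_sup D r x = Sup {t * r x1 + (1 - t) * r x2 | t x1 x2.
     x1 \<in> D \<and> x2 \<in> D \<and> x1 < x2 \<and> 0 \<le> t \<and> t \<le> 1 \<and> x = t * x1 + (1 - t) * x2}"

definition end_modulus ::
    "'a::metric_space set \<Rightarrow> 'a \<Rightarrow> ((real \<Rightarrow> 'a) \<Rightarrow> (real \<Rightarrow> 'b)) \<Rightarrow> real \<Rightarrow> real" where
  "end_modulus T v f =
     (let \<omega> = chord_sup {0..} (oscillation T v f)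
      in if \<omega> 1 = 1 then \<omega> else chord_sup {0..1} (\<lambda>t. if t = 1 then 1 else \<omega> t))"

text \<open>
  The map induced on the trees.  For \<open>x \<in> T\<close>, a branch \<open>F\<close> with \<open>x = F t\<close> passes through \<open>x\<close> at
  time \<open>t = dist v x\<close>.  Such an \<open>F\<close> exists except in the one-point tree \<open>T = {v}\<close>, which is
  vacuously geodesically complete and has no ends at all; there the formula says nothing and the
  induced map is taken to be the constant map to the root \<open>w\<close>.
\<close>

definition induced_map ::
    "'a::metric_space set \<Rightarrow> 'a \<Rightarrow> 'b \<Rightarrow> ((real \<Rightarrow> 'a) \<Rightarrow> (real \<Rightarrow> 'b)) \<Rightarrow> 'a \<Rightarrow> 'b" where
  "induced_map T v w f x =
     (if end_space T v = {} then w
      else let F = (SOME F. F \<in> end_space T v \<and> F (dist v x) = x)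
           in f F (- ln (end_modulus T v f (exp (- dist v x)))))"

definition metrically_proper ::
    "'a::metric_space set \<Rightarrow> 'a \<Rightarrow> 'b::metric_space set \<Rightarrow> 'b \<Rightarrow> ('a \<Rightarrow> 'b) \<Rightarrow> bool" where
  "metrically_proper T v T' w h \<longleftrightarrow>
     h \<in> T \<rightarrow> T' \<and> continuous_on T h \<and> h v = w \<and>
     (\<forall>A. A \<subseteq> T' \<and> bounded A \<longrightarrow> bounded (T \<inter> h -` A))"

lemma end_space_embedding:
  assumes "F \<in> end_space T v" "0 \<le> s" "0 \<le> t"
  shows "F s \<in> T" "dist (F s) (F t) = \<bar>s - t\<bar>" "F 0 = v"
  using assms by (auto simp: end_space_def isometric_embedding_on_def dist_real_def)

lemma arc_between_end:
  assumes F: "F \<in> end_space T v" and t: "0 < t"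
  shows "arc_between T v (F t) (F ` {0..t})"
proof -
  let ?g = "\<lambda>u. F (t * u)"
  have d: "dist (?g a) (?g b) = t * dist a b" if "a \<in> {0..1}" "b \<in> {0..1}" for a b
    using end_space_embedding(2)[OF F, of "t * a" "t * b"] that t
    by (simp add: dist_real_def abs_mult flip: right_diff_distrib)
  have "t-lipschitz_on {0..1} ?g"
    using d t by (intro lipschitz_onI) auto
  then have "path ?g"
    unfolding path_def by (rule lipschitz_on_continuous_on)
  moreover have "inj_on ?g {0..1}"
    proof (rule inj_onI)
    fix a b assume "a \<in> {0..1}" "b \<in> {0..1}" "?g a = ?g b"
    then show "a = b" using d[of a b] t by simp
  qed
  moreover have "path_image ?g = F ` {0..t}"
  proof -
    have "path_image ?g = F ` ((*) t ` {0..1})"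
      unfolding path_image_def by (simp only: image_image)
    then show ?thesis
      using t by simp
  qed
  ultimately show ?thesis
    using t end_space_embedding(1,2)[OF F] end_space_embedding(3)[OF F order.refl order.refl]
    unfolding arc_between_def arc_def pathstart_def pathfinish_def
    by (intro conjI exI[of _ ?g]) auto
qed

lemma end_space_agree:
  assumes T: "R_tree T" and v: "v \<in> T"
    and F: "F \<in> end_space T v" and G: "G \<in> end_space T v"
    and eq: "F t = G t" and st: "0 \<le> s" "s \<le> t"
  shows "F s = G s"
proof (cases "t = 0")
  case True
  then show ?thesis using st eq by simp
next
  case False
  then have t: "0 < t" using st by simp
  have "F t \<noteq> v"
    using end_space_embedding[OF F, of 0 t] t by auto
  moreover have "F t \<in> T"
    using end_space_embedding(1)[OF F, of t] t by auto
  moreover have "\<forall>x\<in>T. \<forall>y\<in>T. x \<noteq> y \<longrightarrow> (\<exists>!A. arc_between T x y A)"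
    using T unfolding R_tree_def uniquely_arcwise_connected_def by (rule conjunct1)
  ultimately have "\<exists>!A. arc_between T v (F t) A"
    using v by (metis (no_types))
  moreover have "arc_between T v (F t) (F ` {0..t})" "arc_between T v (F t) (G ` {0..t})"
    using arc_between_end[OF F t] arc_between_end[OF G t] eq by simp_all
  ultimately have "F ` {0..t} = G ` {0..t}" by (metis (no_types))
  moreover have "F s \<in> F ` {0..t}" using st by simp
  ultimately obtain u where u: "0 \<le> u" "F s = G u" by auto
  have "s = u"
    using end_space_embedding[OF F, of 0 s] end_space_embedding[OF G, of 0 u] st u by auto
  then show ?thesis using u by simp
qed

lemma Metric_space_end_space:
  assumes T: "R_tree T" and v: "v \<in> T"
  shows "Metric_space (end_space T v) end_dist"
proof
  fix F G H :: "real \<Rightarrow> 'a"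
  show "0 \<le> end_dist F G" by (simp add: end_dist_def)
  show "end_dist F G = end_dist G F"
    by (simp add: end_dist_def eq_commute[of F G] eq_commute[of "F _" "G _"])
  show "end_dist F G = 0 \<longleftrightarrow> F = G" by (simp add: end_dist_def)
  assume E: "F \<in> end_space T v" "G \<in> end_space T v" "H \<in> end_space T v"
  have bdd: "bdd_above {t. 0 \<le> t \<and> P t = Q t}"
    if PQ: "P \<in> end_space T v" "Q \<in> end_space T v" "P \<noteq> Q" for P Q
  proof -
    obtain s where s: "0 \<le> s" "P s \<noteq> Q s"
      using PQ extensionalityI[of P "{0..}" Q] unfolding end_space_def by auto
    then show ?thesis
      using end_space_agree[OF T v PQ(1,2), where s = s]
      by (intro bdd_aboveI[of _ s]) (metis (mono_tags, lifting) linorder_le_cases mem_Collect_eq)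
  qed
  have ex: "\<exists>t. s < t \<and> 0 \<le> t \<and> P t = Q t"
    if PQ: "P \<in> end_space T v" "Q \<in> end_space T v" "s < Sup {t. 0 \<le> t \<and> P t = Q t}" for P Q s
  proof -
    have "0 \<in> {t. 0 \<le> t \<and> P t = Q t}"
      using PQ by (simp add: end_space_def)
    then show ?thesis
      using less_cSupD[OF _ PQ(3)] by blast
  qed
  show "end_dist F H \<le> end_dist F G + end_dist G H"
  proof (cases "F = G \<or> G = H \<or> F = H")
    case True
    then show ?thesis by (auto simp: end_dist_def)
  next
    case False
    let ?S = "\<lambda>P Q. Sup {t. 0 \<le> t \<and> P t = Q t}"
    have "min (?S F G) (?S G H) \<le> ?S F H"
    proof (rule dense_le)
      fix s assume s: "s < min (?S F G) (?S G H)"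
      obtain a b where "s < a" "0 \<le> a" "F a = G a" "s < b" "0 \<le> b" "G b = H b"
        using ex[OF E(1,2), of s] ex[OF E(2,3), of s] s by auto
      then have "max 0 s \<in> {t. 0 \<le> t \<and> F t = H t}"
        using end_space_agree[OF T v E(1,2), of a "max 0 s"]
          end_space_agree[OF T v E(2,3), of b "max 0 s"] by simp
      then have "max 0 s \<le> ?S F H"
        using bdd[OF E(1,3)] False by (intro cSup_upper) auto
      then show "s \<le> ?S F H" by simp
    qed
    then have "exp (- ?S F H) \<le> exp (- ?S F G) \<or> exp (- ?S F H) \<le> exp (- ?S G H)"
      by (simp add: min_le_iff_disj)
    then have "exp (- ?S F H) \<le> exp (- ?S F G) + exp (- ?S G H)"
      using exp_ge_zero[of "- ?S F G"] exp_ge_zero[of "- ?S G H"] by linarith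
    then show ?thesis using False by (simp add: end_dist_def)
  qed
qed

lemma mspace_end_metric:
  "R_tree T \<Longrightarrow> v \<in> T \<Longrightarrow> mspace (end_metric T v) = end_space T v"
  unfolding end_metric_def by (intro Metric_space.mspace_metric Metric_space_end_space)

lemma mdist_end_metric:
  "R_tree T \<Longrightarrow> v \<in> T \<Longrightarrow> mdist (end_metric T v) = end_dist"
  unfolding end_metric_def by (intro Metric_space.mdist_metric Metric_space_end_space)

end

theory Submission
  imports Defs
begin

text \<open>
  The chord supremum of a bounded function is its least concave majorant.  Hence \<open>\<lambda>\<close> is concave and
  lies between the identity and 1 on \<open>[0,1]\<close>, so that \<open>\<phi> t = - ln (\<lambda> (exp (- t)))\<close> is continuous with
  \<open>0 \<le> \<phi> t \<le> t\<close>; uniform continuity of \<open>f\<close> gives \<open>\<lambda> x \<rightarrow> 0\<close> as \<open>x \<rightarrow> 0\<close>, that is, \<open>\<phi> t \<rightarrow> \<infinity>\<close> as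
  \<open>t \<rightarrow> \<infinity>\<close>.  Branches \<open>F\<close>, \<open>G\<close> that agree up to time \<open>t\<close> are sent to branches that agree up to time
  \<open>\<phi> t\<close>, so \<open>F t\<close> is sent to \<open>f F (\<phi> t)\<close> for every branch \<open>F\<close> through it.  Two points \<open>F t\<close>, \<open>G s\<close> of
  the tree are joined through a common point \<open>F m = G m\<close> at distance at most \<open>dist (F t) (G s)\<close> from
  both, whence continuity; properness follows because the image of \<open>F t\<close> is at distance \<open>\<phi> t\<close> from
  the root.
\<close>

section \<open>Chord suprema\<close>

lemma convex_combination_le_affine:
  fixes r :: "real \<Rightarrow> real"
  assumes "0 \<le> t" "t \<le> 1" "r x1 \<le> a + b * x1" "r x2 \<le> a + b * x2"
  shows "t * r x1 + (1 - t) * r x2 \<le> a + b * (t * x1 + (1 - t) * x2)"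
proof -
  have "t * r x1 + (1 - t) * r x2 \<le> t * (a + b * x1) + (1 - t) * (a + b * x2)"
    using assms by (intro add_mono mult_left_mono) auto
  then show ?thesis by (simp add: algebra_simps)
qed

text \<open>The bound \<open>B\<close> on \<open>r\<close> bounds all chord values, so the
  \<open>Sup\<close> is a genuine least upper bound.\<close>

lemma chord_sup_upper:
  assumes B: "\<And>z. z \<in> D \<Longrightarrow> r z \<le> B"
    and "x1 \<in> D" "x2 \<in> D" "x1 < x2" "0 \<le> t" "t \<le> 1"
  shows "t * r x1 + (1 - t) * r x2 \<le> chord_sup D r (t * x1 + (1 - t) * x2)"
proof -
  have "bdd_above {t * r x1 + (1 - t) * r x2 | t x1 x2.
     x1 \<in> D \<and> x2 \<in> D \<and> x1 < x2 \<and> 0 \<le> t \<and> t \<le> 1 \<and> x = t * x1 + (1 - t) * x2}" for x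
  proof (rule bdd_aboveI[of _ B], clarify)
    fix t x1 x2 :: real assume "x1 \<in> D" "x2 \<in> D" "0 \<le> t" "t \<le> 1"
    then show "t * r x1 + (1 - t) * r x2 \<le> B"
      using convex_combination_le_affine[of t r x1 B 0 x2] B by simp
  qed
  then show ?thesis
    unfolding chord_sup_def using assms(2-) by (intro cSup_upper) blast+
qed

text \<open>A chord ending at \<open>x\<close> takes the value \<open>r x\<close> there;
  \<open>y\<close> supplies its other end.\<close>

lemma le_chord_sup:
  assumes B: "\<And>z. z \<in> D \<Longrightarrow> r z \<le> B" and xy: "x \<in> D" "y \<in> D" "y \<noteq> x"
  shows "r x \<le> chord_sup D r x"
proof (cases "x < y")
  case True
  then show ?thesis using chord_sup_upper[of D r B x y 1] B xy by simp
next
  case False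
  then show ?thesis using chord_sup_upper[of D r B y x 0] B xy by simp
qed

text \<open>Affine functions equal their own chords, so an affine majorant of \<open>r\<close>
  majorizes every chord of \<open>r\<close>. The point \<open>y\<close> makes the set of chords over
  \<open>x\<close> nonempty.\<close>

lemma chord_sup_le_affine:
  assumes r: "\<And>z. z \<in> D \<Longrightarrow> r z \<le> a + b * z" and xy: "x \<in> D" "y \<in> D" "y \<noteq> x"
  shows "chord_sup D r x \<le> a + b * x"
  unfolding chord_sup_def
proof (rule cSup_least)
  show "{t * r x1 + (1 - t) * r x2 | t x1 x2.
     x1 \<in> D \<and> x2 \<in> D \<and> x1 < x2 \<and> 0 \<le> t \<and> t \<le> 1 \<and> x = t * x1 + (1 - t) * x2} \<noteq> {}"
  proof (cases "x < y")
    case True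
    then have "\<exists>x1 x2. x1 \<in> D \<and> x2 \<in> D \<and> x1 < x2 \<and> 0 \<le> (1::real) \<and> (1::real) \<le> 1 \<and> x = 1 * x1 + (1 - 1) * x2"
      using xy by (intro exI[of _ x] exI[of _ y]) simp
    then show ?thesis by blast
  next
    case False
    then have "\<exists>x1 x2. x1 \<in> D \<and> x2 \<in> D \<and> x1 < x2 \<and> 0 \<le> (0::real) \<and> (0::real) \<le> 1 \<and> x = 0 * x1 + (1 - 0) * x2"
      using xy by (intro exI[of _ y] exI[of _ x]) simp
    then show ?thesis by blast
  qed
qed (use convex_combination_le_affine r in blast)

text \<open>The slope of the supporting line separates the slopes of the chords to the right of \<open>x\<close> from
  those to the left.\<close>

lemma chord_sup_supporting_line:
  assumes B: "\<And>z. z \<in> D \<Longrightarrow> r z \<le> B"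
    and x: "x \<in> D" and p: "p \<in> D" "p < x" and q: "q \<in> D" "x < q"
  obtains k where "\<And>z. z \<in> D \<Longrightarrow> chord_sup D r z \<le> chord_sup D r x + k * (z - x)"
proof -
  define c where "c = chord_sup D r x"
  have slope: "(r x2 - c) / (x2 - x) \<le> (c - r x1) / (x - x1)"
    if h: "x1 \<in> D" "x2 \<in> D" "x1 < x" "x < x2" for x1 x2
  proof -
    \<comment> \<open>The weight that writes \<open>x\<close> as a convex combination of
      \<open>x1\<close> and \<open>x2\<close>.\<close>
    let ?t = "(x2 - x) / (x2 - x1)"
    have t: "0 \<le> ?t" "?t \<le> 1" using h by (auto simp: field_simps)
    have u: "1 - ?t = (x - x1) / (x2 - x1)" using h by (simp add: field_simps)
    have "?t * x1 + (1 - ?t) * x2 = ((x2 - x) * x1 + (x - x1) * x2) / (x2 - x1)"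
      unfolding u by (simp add: add_divide_distrib)
    also have "(x2 - x) * x1 + (x - x1) * x2 = x * (x2 - x1)"
      by (simp add: algebra_simps)
    finally have "?t * x1 + (1 - ?t) * x2 = x" using h by simp
    then have "?t * r x1 + (1 - ?t) * r x2 \<le> c"
      using chord_sup_upper[of D r B x1 x2 ?t] B h t unfolding c_def by simp
    then have "((x2 - x) * r x1 + (x - x1) * r x2) / (x2 - x1) \<le> c"
      unfolding u by (simp add: add_divide_distrib)
    then have "(x2 - x) * r x1 + (x - x1) * r x2 \<le> c * (x2 - x1)"
      using h by (simp add: pos_divide_le_eq)
    then have "(r x2 - c) * (x - x1) \<le> (c - r x1) * (x2 - x)"
      by (simp add: algebra_simps)
    then show ?thesis
      using h by (simp add: divide_simps)
  qed
  \<comment> \<open>The slope from \<open>p\<close> bounds these slopes above and \<open>q\<close>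
    keeps the set nonempty, so the \<open>Sup\<close> is meaningful.\<close>
  define k where "k = Sup ((\<lambda>x2. (r x2 - c) / (x2 - x)) ` {z \<in> D. x < z})"
  have right: "(r z - c) / (z - x) \<le> k" if "z \<in> D" "x < z" for z
    unfolding k_def
    by (rule cSup_upper) (use that p slope in \<open>auto intro!: bdd_aboveI[of _ "(c - r p) / (x - p)"]\<close>)
  have left: "k \<le> (c - r z) / (x - z)" if "z \<in> D" "z < x" for z
    unfolding k_def by (rule cSup_least) (use that q slope in auto)
  have "r z \<le> (c - k * x) + k * z" if "z \<in> D" for z
  proof -
    consider "z < x" | "z = x" | "x < z" by linarith
    then have "r z \<le> c + k * (z - x)"
    proof cases
      case 1
      then show ?thesis using left[OF that] by (simp add: field_simps)
    next
      case 2
      then show ?thesis using le_chord_sup[of D r B x p] B x p unfolding c_def by simp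
    next
      case 3
      then show ?thesis using right[OF that] by (simp add: field_simps)
    qed
    then show ?thesis by (simp add: algebra_simps)
  qed
  then have "chord_sup D r z \<le> (c - k * x) + k * z" if "z \<in> D" for z
    using that p q by (intro chord_sup_le_affine[where y = "if z = p then q else p"]) auto
  then show thesis
    by (intro that[of k]) (simp add: algebra_simps c_def)
qed

text \<open>The supporting line at the intermediate point lies above the function at both ends;
  averaging the two bounds cancels the slope.\<close>

lemma concave_on_chord_sup:
  assumes B: "\<And>z. z \<in> D \<Longrightarrow> r z \<le> B" and D: "convex D"
  shows "concave_on D (chord_sup D r)"
proof
  fix t x y :: real
  assume t: "0 < t" "t < 1" and xy: "x \<in> D" "y \<in> D" "x < y"
  let ?z = "(1 - t) *\<^sub>R x + t *\<^sub>R y"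
  have z: "?z \<in> D"
    using convexD_alt[OF D xy(1,2), of t] t by simp
  have "?z - x = t * (y - x)" "y - ?z = (1 - t) * (y - x)"
    by (simp_all add: algebra_simps)
  then have "x < ?z" "?z < y"
    using t xy by (metis diff_gt_0_iff_gt mult_pos_pos)+
  then obtain k where k: "\<And>u. u \<in> D \<Longrightarrow> chord_sup D r u \<le> chord_sup D r ?z + k * (u - ?z)"
    using chord_sup_supporting_line[of D r B ?z x y] B z xy by blast
  have "(1 - t) * chord_sup D r x + t * chord_sup D r y \<le>
      (1 - t) * (chord_sup D r ?z + k * (x - ?z)) + t * (chord_sup D r ?z + k * (y - ?z))"
    using k xy t by (intro add_mono mult_left_mono) auto
  also have "\<dots> = chord_sup D r ?z" by (simp add: algebra_simps)
  finally show "(1 - t) * chord_sup D r x + t * chord_sup D r y \<le> chord_sup D r ?z" .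
qed (rule D)

section \<open>Concave functions on the unit interval\<close>

lemma ge_self_of_concave_on:
  fixes h :: "real \<Rightarrow> real"
  assumes h: "concave_on {0..1} h" "0 \<le> h 0" "h 1 = 1" and x: "x \<in> {0..1}"
  shows "x \<le> h x"
proof -
  \<comment> \<open>The graph lies above its chord from \<open>(0, h 0)\<close> to
    \<open>(1, 1)\<close>, which lies above the diagonal.\<close>
  have "(1 - x) * h 0 + x * h 1 \<le> h ((1 - x) *\<^sub>R 0 + x *\<^sub>R 1)"
    using x by (intro concave_onD[OF h(1)]) auto
  moreover have "0 \<le> (1 - x) * h 0" using h x by simp
  ultimately show ?thesis using h by simp
qed

text \<open>Concavity gives continuity in the open interval; at the end point 1 the function is
  squeezed between the identity and 1.\<close>

lemma continuous_on_concave_modulus: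
  fixes h :: "real \<Rightarrow> real"
  assumes conc: "concave_on {0..1} h" and ge: "\<And>x. x \<in> {0..1} \<Longrightarrow> x \<le> h x"
    and le: "\<And>x. x \<in> {0..1} \<Longrightarrow> h x \<le> 1"
  shows "continuous_on {0<..1} h"
  unfolding continuous_on_eq_continuous_within
proof
  fix x :: real assume x: "x \<in> {0<..1}"
  show "continuous (at x within {0<..1}) h"
  proof (cases "x = 1")
    case True
    have "h 1 = 1" using ge[of 1] le[of 1] by simp
    moreover have "(h \<longlongrightarrow> 1) (at 1 within {0<..1})"
    proof (rule tendsto_sandwich)
      show "\<forall>\<^sub>F y in at 1 within {0<..1}. y \<le> h y" "\<forall>\<^sub>F y in at 1 within {0<..1}. h y \<le> 1"
        using ge le by (auto simp: eventually_at_filter)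
    qed (rule tendsto_ident_at tendsto_const)+
    ultimately show ?thesis using True by (simp add: continuous_within)
  next
    case False
    have "convex_on {0<..<1} (\<lambda>x. - h x)"
      using conc unfolding concave_on_def by (rule convex_on_subset) auto
    then have "continuous_on {0<..<1} (\<lambda>x. - (- h x))"
      by (intro continuous_on_minus convex_on_continuous) auto
    then have "continuous (at x) h"
      using False x by (simp add: continuous_on_eq_continuous_at)
    then show ?thesis by (rule continuous_at_imp_continuous_at_within)
  qed
qed

section \<open>Branches of a tree\<close>

text \<open>For \<open>u < m\<close> both branches move only \<open>m - u\<close> away from their
  common value at \<open>u\<close>, so their distance at \<open>m\<close> is at most
  \<open>2 * (m - u)\<close>.\<close>

lemma end_space_agree_limit:
  assumes F: "F \<in> end_space T v" and G: "G \<in> end_space T v" and m: "0 \<le> m"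
    and eq: "\<And>u. 0 \<le> u \<Longrightarrow> u < m \<Longrightarrow> F u = G u"
  shows "F m = G m"
proof (cases "m = 0")
  case True
  then show ?thesis using F G by (simp add: end_space_def)
next
  case False
  have "dist (F m) (G m) \<le> 0 + e" if "0 < e" for e
  proof -
    define u where "u = max 0 (m - e / 2)"
    have u: "0 \<le> u" "u < m" "m - u \<le> e / 2" using False m that by (auto simp: u_def max_def)
    have "dist (F m) (G m) \<le> dist (F m) (F u) + dist (G m) (G u)"
      using eq[OF u(1,2)] by (metis dist_triangle2)
    also have "\<dots> = 2 * (m - u)"
      using end_space_embedding(2)[OF F m u(1)] end_space_embedding(2)[OF G m u(1)] u by simp
    finally show ?thesis using u by simp
  qed
  then have "dist (F m) (G m) \<le> 0" by (rule field_le_epsilon)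
  then show ?thesis by simp
qed

section \<open>Agreement times of branches and the end distance\<close>

lemma bdd_above_end_space_agree:
  assumes T: "R_tree T" and v: "v \<in> T"
    and F: "F \<in> end_space T v" and G: "G \<in> end_space T v" and ne: "F \<noteq> G"
  shows "bdd_above {t. 0 \<le> t \<and> F t = G t}"
proof -
  obtain s where s: "0 \<le> s" "F s \<noteq> G s"
    using F G ne extensionalityI[of F "{0..}" G] unfolding end_space_def by auto
  then show ?thesis
    using end_space_agree[OF T v F G, where s = s]
    by (intro bdd_aboveI[of _ s]) (metis (mono_tags, lifting) linorder_le_cases mem_Collect_eq)
qed

lemma end_dist_le_one:
  assumes "R_tree T" "v \<in> T" "F \<in> end_space T v" "G \<in> end_space T v"
  shows "end_dist F G \<le> 1"
proof (cases "F = G")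
  case False
  then have "0 \<le> Sup {t. 0 \<le> t \<and> F t = G t}"
    using assms bdd_above_end_space_agree[OF assms False]
    by (intro cSup_upper) (auto simp: end_space_def)
  then show ?thesis using False by (simp add: end_dist_def)
qed (simp add: end_dist_def)

text \<open>The supremum of the agreement times is attained, and agreement passes to earlier times.
  This turns estimates on end distances into equality of points, in both trees.\<close>

lemma end_dist_le_exp_iff:
  assumes T: "R_tree T" and v: "v \<in> T"
    and F: "F \<in> end_space T v" and G: "G \<in> end_space T v" and t: "0 \<le> t"
  shows "end_dist F G \<le> exp (- t) \<longleftrightarrow> F t = G t"
proof (cases "F = G")
  case False
  let ?S = "{t. 0 \<le> t \<and> F t = G t}"
  have 0: "0 \<in> ?S" using F G by (simp add: end_space_def)
  have "t \<le> Sup ?S \<longleftrightarrow> F t = G t"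
  proof
    assume le: "t \<le> Sup ?S"
    show "F t = G t"
    proof (rule end_space_agree_limit[OF F G t])
      fix u assume u: "0 \<le> u" "u < t"
      then obtain s where "s \<in> ?S" "u < s"
        using less_cSupD[of ?S u] 0 le by fastforce
      then show "F u = G u" using end_space_agree[OF T v F G, of s u] u by simp
    qed
  qed (use bdd_above_end_space_agree[OF T v F G False] t in \<open>auto intro: cSup_upper\<close>)
  then show ?thesis using False by (simp add: end_dist_def)
qed (simp add: end_dist_def)

lemma R_tree_dist_arc_point:
  assumes T: "R_tree T" and A: "arc_between T x y A" and p: "p \<in> A"
  shows "dist x p + dist p y = dist x y"
proof -
  have xy: "x \<in> A" "y \<in> A" "A \<subseteq> T"
    using A pathstart_in_path_image pathfinish_in_path_image by (auto simp: arc_between_def)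
  then obtain h where h: "isometric_embedding_on {0..dist x y} A h" "h ` {0..dist x y} = A"
    using T A unfolding R_tree_def by (meson subsetD)
  obtain a b c where abc: "a \<in> {0..dist x y}" "b \<in> {0..dist x y}" "c \<in> {0..dist x y}"
    and eq: "x = h a" "y = h b" "p = h c"
    using xy p unfolding h(2)[symmetric] by blast
  have "dist x y = \<bar>a - b\<bar>" "dist x p = \<bar>a - c\<bar>" "dist p y = \<bar>c - b\<bar>"
    using h(1) abc unfolding isometric_embedding_on_def eq dist_real_def by blast+
  \<comment> \<open>Since \<open>a\<close> and \<open>b\<close> differ by the full length of the
    interval, they are its two end points and \<open>c\<close> lies between them.\<close>
  then show ?thesis using abc by auto
qed

section \<open>Arcs along branches\<close>

lemma arc_end_segment:
  assumes F: "F \<in> end_space T v" and m: "0 \<le> m" "m < t"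
  defines "g \<equiv> \<lambda>u. F (m + (t - m) * u)"
  shows "arc g" "pathstart g = F m" "pathfinish g = F t" "path_image g = F ` {m..t}"
proof -
  have d: "dist (g a) (g b) = (t - m) * dist a b" if "a \<in> {0..1}" "b \<in> {0..1}" for a b
    using end_space_embedding(2)[OF F, of "m + (t - m) * a" "m + (t - m) * b"] that m
    by (simp add: g_def dist_real_def abs_mult flip: right_diff_distrib)
  have "(t - m)-lipschitz_on {0..1} g"
    using d m by (intro lipschitz_onI) auto
  then have "path g"
    unfolding path_def by (rule lipschitz_on_continuous_on)
  moreover have "inj_on g {0..1}"
  proof (rule inj_onI)
    fix a b assume "a \<in> {0..1}" "b \<in> {0..1}" "g a = g b"
    then show "a = b" using d[of a b] m by simp
  qed
  ultimately show "arc g" by (simp add: arc_def)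
  show "pathstart g = F m" "pathfinish g = F t"
    by (simp_all add: g_def pathstart_def pathfinish_def)
  have "(\<lambda>u. m + (t - m) * u) ` {0..1} = {m..t}"
    using m image_affinity_atLeastAtMost[of "t - m" m 0 1] by (simp add: add.commute)
  then show "path_image g = F ` {m..t}"
    unfolding path_image_def g_def by (metis image_image)
qed

text \<open>The parameter of a point on a branch is its distance from the root.\<close>

lemma end_space_same_time:
  assumes "F \<in> end_space T v" "G \<in> end_space T v" "0 \<le> a" "0 \<le> b" "F a = G b"
  shows "a = b"
proof -
  have "F 0 = v" "G 0 = v" using assms by (simp_all add: end_space_def)
  then have "dist v (F a) = a" "dist v (G b) = b"
    using assms end_space_embedding(2)[OF assms(1), of 0 a] end_space_embedding(2)[OF assms(2), of 0 b]
    by simp_all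
  then show ?thesis using assms(5) by simp
qed

text \<open>Take the last common time \<open>m\<close> up to \<open>min t s\<close>. If both
  branches continue beyond it, the two remaining segments form an arc, whose length is the distance
  of its ends.\<close>

lemma branches_common_point:
  assumes T: "R_tree T" and v: "v \<in> T"
    and F: "F \<in> end_space T v" and G: "G \<in> end_space T v" and t: "0 \<le> t" and s: "0 \<le> s"
  obtains m where "0 \<le> m" "m \<le> t" "m \<le> s" "F m = G m"
    "t - m \<le> dist (F t) (G s)" "s - m \<le> dist (F t) (G s)"
proof -
  \<comment> \<open>The cap \<open>min t s\<close> keeps the set bounded even when
    \<open>F = G\<close>.\<close>
  let ?S = "{u. 0 \<le> u \<and> u \<le> min t s \<and> F u = G u}"
  define m where "m = Sup ?S"
  have 0: "F 0 = v" "G 0 = v" using F G by (auto simp: end_space_def)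
  have ne: "0 \<in> ?S" using 0 t s by simp
  have bdd: "bdd_above ?S" by (rule bdd_aboveI[of _ t]) auto
  have m: "0 \<le> m" "m \<le> t" "m \<le> s"
    unfolding m_def using ne bdd by (auto intro!: cSup_upper cSup_least)
  have Fm: "F m = G m"
  proof (rule end_space_agree_limit[OF F G m(1)])
    fix u assume u: "0 \<le> u" "u < m"
    then obtain u' where "u' \<in> ?S" "u < u'"
      using less_cSupD[of ?S u] ne unfolding m_def by auto
    then show "F u = G u" using end_space_agree[OF T v F G, of u' u] u by simp
  qed
  have rad: "dist v (F t) = t" "dist v (G s) = s" "dist (F t) (F m) = t - m" "dist (G m) (G s) = s - m"
    using end_space_embedding(2)[OF F, of 0 t] end_space_embedding(2)[OF G, of 0 s]
      end_space_embedding(2)[OF F, of t m] end_space_embedding(2)[OF G, of m s] 0 m t s by auto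
  have "\<bar>t - s\<bar> \<le> dist (F t) (G s)"
    using dist_triangle[of v "F t" "G s"] dist_triangle[of v "G s" "F t"] rad
    by (simp add: dist_commute)
  moreover have "t - m + (s - m) = dist (F t) (G s)" if "m < t" "m < s"
  proof -
    define g where "g = reversepath (\<lambda>u. F (m + (t - m) * u)) +++ (\<lambda>u. G (m + (s - m) * u))"
    note aF = arc_end_segment[OF F m(1) that(1)] and aG = arc_end_segment[OF G m(1) that(2)]
    \<comment> \<open>A common point is reached at the same time on both branches, hence not after
      \<open>m\<close>.\<close>
    have "F ` {m..t} \<inter> G ` {m..s} \<subseteq> {G m}"
    proof
      fix p assume "p \<in> F ` {m..t} \<inter> G ` {m..s}"
      then obtain a b where h: "a \<in> {m..t}" "b \<in> {m..s}" "F a = G b" "p = G b" by auto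
      then have "a = b" using m by (intro end_space_same_time[OF F G]) auto
      then have "a \<in> ?S" using h m by auto
      then have "a \<le> m" unfolding m_def using bdd by (rule cSup_upper)
      then show "p \<in> {G m}" using h \<open>a = b\<close> by auto
    qed
    then have "arc g"
      unfolding g_def using aF aG Fm by (intro arc_join arc_reversepath) simp_all
    moreover have "path_image g = F ` {m..t} \<union> G ` {m..s}"
      unfolding g_def using aF aG Fm by (subst path_image_join) simp_all
    moreover have "pathstart g = F t" "pathfinish g = G s"
      unfolding g_def using aF aG by simp_all
    moreover have "F ` {m..t} \<union> G ` {m..s} \<subseteq> T"
      using end_space_embedding(1)[OF F] end_space_embedding(1)[OF G] m by auto
    ultimately have "arc_between T (F t) (G s) (F ` {m..t} \<union> G ` {m..s})"
      unfolding arc_between_def by blast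
    then have "dist (F t) (F m) + dist (F m) (G s) = dist (F t) (G s)"
      by (rule R_tree_dist_arc_point[OF T]) (use m in auto)
    then show ?thesis using rad Fm by simp
  qed
  \<comment> \<open>If \<open>m\<close> equals \<open>t\<close> or \<open>s\<close>, one difference
    vanishes and the other is \<open>\<bar>t - s\<bar>\<close>.\<close>
  ultimately have "t - m \<le> dist (F t) (G s)" "s - m \<le> dist (F t) (G s)"
    using m by fastforce+
  then show thesis using that[OF m Fm] by simp
qed

lemma geodesically_complete_branch:
  assumes T: "R_tree T" and v: "v \<in> T" and gc: "geodesically_complete T v"
    and x: "x \<in> T" "x \<noteq> v"
  obtains F where "F \<in> end_space T v" "F (dist v x) = x"
proof -
  let ?d = "dist v x"
  have d: "0 < ?d" using x by simp
  obtain A where A: "arc_between T v x A"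
    using T v x unfolding R_tree_def uniquely_arcwise_connected_def by metis
  then have vx: "v \<in> A" "x \<in> A" "A \<subseteq> T"
    using pathstart_in_path_image pathfinish_in_path_image by (auto simp: arc_between_def)
  obtain h where h: "isometric_embedding_on {0..?d} A h" "h ` {0..?d} = A"
    using T v x A unfolding R_tree_def by meson
  obtain a b where ab: "a \<in> {0..?d}" "b \<in> {0..?d}" and eq: "v = h a" "x = h b"
    using vx unfolding h(2)[symmetric] by blast
  have "dist (h a) (h b) = \<bar>a - b\<bar>"
    using h(1) ab unfolding isometric_embedding_on_def dist_real_def by blast
  then have ab': "a = 0 \<and> b = ?d \<or> a = ?d \<and> b = 0" using ab eq by auto
  \<comment> \<open>The isometry \<open>h\<close> may run from \<open>x\<close> to \<open>v\<close>;
    in that case it is reversed.\<close>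
  define g where "g = (if a = 0 then h else (\<lambda>u. h (?d - u)))"
  have iso: "isometric_embedding_on {0..?d} T g"
  proof -
    have "isometric_embedding_on {0..?d} A (\<lambda>u. h (?d - u))"
      using h(1) unfolding isometric_embedding_on_def Pi_iff
      by (auto simp: dist_real_def abs_minus_commute)
    then show ?thesis
      using h(1) vx(3) unfolding isometric_embedding_on_def g_def by (auto split: if_splits)
  qed
  have ends: "g 0 = v" "g ?d = x"
    using ab' eq d by (auto simp: g_def)
  obtain F where F: "isometric_embedding_on {0..} T F" "\<forall>s\<in>{0..?d}. F s = g s"
    using gc d iso ends unfolding geodesically_complete_def by blast
  \<comment> \<open>Members of \<open>end_space\<close> are extensional, so the extension is cut
    down to \<open>{0..}\<close>.\<close>
  have "restrict F {0..} \<in> end_space T v"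
    using F ends d by (auto simp: end_space_def isometric_embedding_on_def)
  moreover have "restrict F {0..} ?d = x" using F ends d by simp
  ultimately show thesis by (rule that)
qed

section \<open>The modulus and the induced map\<close>

text \<open>An end is assumed to exist so that, at nonnegative arguments, the supremum in
  \<open>oscillation\<close> runs over a nonempty set.\<close>

locale end_space_map =
  fixes T :: "'a::metric_space set" and v :: 'a
    and T' :: "'b::metric_space set" and w :: 'b
    and f :: "(real \<Rightarrow> 'a) \<Rightarrow> (real \<Rightarrow> 'b)"
  assumes T: "R_tree T" and v: "v \<in> T" and T': "R_tree T'" and w: "w \<in> T'"
    and uc: "uniformly_continuous_map (end_metric T v) (end_metric T' w) f"
    and ends: "end_space T v \<noteq> {}"
begin

abbreviation "\<rho> \<equiv> oscillation T v f"
abbreviation "\<omega> \<equiv> chord_sup {0..} \<rho>"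
abbreviation "modulus \<equiv> end_modulus T v f"

definition "\<phi> t = - ln (modulus (exp (- t)))"

lemma maps_ends: "F \<in> end_space T v \<Longrightarrow> f F \<in> end_space T' w"
  using uniformly_continuous_map_funspace[OF uc]
  by (auto simp: mspace_end_metric[OF T v] mspace_end_metric[OF T' w])

lemma bdd_above_oscillation:
  "bdd_above {end_dist (f F) (f G) | F G.
     F \<in> end_space T v \<and> G \<in> end_space T v \<and> end_dist F G \<le> \<delta>}"
  by (rule bdd_aboveI[of _ 1]) (auto intro!: end_dist_le_one[OF T' w] maps_ends)

lemma end_dist_le_oscillation:
  "F \<in> end_space T v \<Longrightarrow> G \<in> end_space T v \<Longrightarrow> end_dist F G \<le> \<delta> \<Longrightarrow> end_dist (f F) (f G) \<le> \<rho> \<delta>"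
  unfolding oscillation_def by (rule cSup_upper[OF _ bdd_above_oscillation]) blast

lemma oscillation_le:
  assumes "0 \<le> \<delta>"
    and "\<And>F G. F \<in> end_space T v \<Longrightarrow> G \<in> end_space T v \<Longrightarrow> end_dist F G \<le> \<delta> \<Longrightarrow>
      end_dist (f F) (f G) \<le> B"
  shows "\<rho> \<delta> \<le> B"
  unfolding oscillation_def
proof (rule cSup_least)
  obtain F where "F \<in> end_space T v" using ends by blast
  moreover have "end_dist F F \<le> \<delta>" using assms by (simp add: end_dist_def)
  ultimately show "{end_dist (f F) (f G) | F G.
     F \<in> end_space T v \<and> G \<in> end_space T v \<and> end_dist F G \<le> \<delta>} \<noteq> {}" by blast
qed (use assms in auto)

lemma oscillation_nonneg:
  assumes "0 \<le> \<delta>" shows "0 \<le> \<rho> \<delta>"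
proof -
  obtain F where F: "F \<in> end_space T v" using ends by blast
  have "end_dist (f F) (f F) \<le> \<rho> \<delta>"
    using assms by (intro end_dist_le_oscillation[OF F F]) (simp add: end_dist_def)
  then show ?thesis by (simp add: end_dist_def)
qed

lemma oscillation_le_one: "0 \<le> \<delta> \<Longrightarrow> \<rho> \<delta> \<le> 1"
  by (rule oscillation_le) (auto intro!: end_dist_le_one[OF T' w] maps_ends)

text \<open>Uniform continuity bounds \<open>\<rho>\<close> by \<open>e\<close> below some
  \<open>d\<close>; from \<open>d\<close> on, the slope \<open>1 / d\<close> already brings the line
  above 1. Unlike a bare limit at 0, an affine bound passes directly through chord suprema.\<close>

lemma oscillation_affine_bound:
  assumes "0 < e"
  obtains C where "0 \<le> C" "\<And>x. 0 \<le> x \<Longrightarrow> \<rho> x \<le> e + C * x"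
proof -
  obtain d where d: "0 < d" "\<And>F G. F \<in> end_space T v \<Longrightarrow> G \<in> end_space T v \<Longrightarrow>
      end_dist G F < d \<Longrightarrow> end_dist (f G) (f F) < e"
    using uc assms unfolding uniformly_continuous_map_def mspace_end_metric[OF T v]
      mdist_end_metric[OF T v] mdist_end_metric[OF T' w] by blast
  have "\<rho> x \<le> e + 1 / d * x" if "0 \<le> x" for x
  proof (cases "x < d")
    case True
    then have "\<rho> x \<le> e" using d(2) that by (intro oscillation_le) (auto intro!: less_imp_le)
    moreover have "0 \<le> 1 / d * x" using d that by simp
    ultimately show ?thesis by linarith
  next
    case False
    then have "1 \<le> 1 / d * x" using d by simp
    then show ?thesis using oscillation_le_one[OF that] assms by linarith
  qed
  then show thesis using that[of "1 / d"] d by simp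
qed

section \<open>Concave majorants of the oscillation\<close>

lemma chord_sup_oscillation:
  assumes "0 \<le> x"
  shows "\<rho> x \<le> \<omega> x" "\<omega> x \<le> 1"
  using assms le_chord_sup[of "{0..}" \<rho> 1 x "x + 1"] chord_sup_le_affine[of "{0..}" \<rho> 1 0 x "x + 1"]
    oscillation_le_one by auto

lemma chord_sup_oscillation_affine:
  assumes "\<And>x. 0 \<le> x \<Longrightarrow> \<rho> x \<le> a + b * x" "0 \<le> x"
  shows "\<omega> x \<le> a + b * x"
  using assms by (intro chord_sup_le_affine[where y = "x + 1"]) auto

text \<open>The second stage of the construction: the value at 1 is raised to 1, and a further chord
  supremum over \<open>{0..1}\<close> restores concavity.\<close>

abbreviation "\<omega>1 \<equiv> (\<lambda>t. if t = 1 then 1 else \<omega> t)"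

lemma end_modulus_cases:
  obtains "\<omega> 1 = 1" "modulus = \<omega>" | "\<omega> 1 \<noteq> 1" "modulus = chord_sup {0..1} \<omega>1"
  by (auto simp: end_modulus_def Let_def split: if_splits)

lemma omega1_le_one: "z \<in> {0..1} \<Longrightarrow> \<omega>1 z \<le> 1"
  using chord_sup_oscillation by auto

lemma omega1_le_chord_sup:
  "x \<in> {0..1} \<Longrightarrow> \<omega>1 x \<le> chord_sup {0..1} \<omega>1 x"
  \<comment> \<open>The conditional picks a point of \<open>{0..1}\<close> other than
    \<open>x\<close>.\<close>
  using omega1_le_one by (intro le_chord_sup[of _ _ 1 _ "if x = 0 then 1 else 0"]) auto

lemma chord_sup_omega1_affine:
  assumes "\<And>z. z \<in> {0..1} \<Longrightarrow> \<omega>1 z \<le> a + b * z" "x \<in> {0..1}"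
  shows "chord_sup {0..1} \<omega>1 x \<le> a + b * x"
  using assms by (intro chord_sup_le_affine[where y = "if x = 0 then 1 else 0"]) auto

lemma oscillation_le_end_modulus:
  assumes "x \<in> {0..1}" shows "\<rho> x \<le> modulus x"
proof (rule end_modulus_cases)
  assume "modulus = chord_sup {0..1} \<omega>1"
  moreover have "\<rho> x \<le> \<omega>1 x"
    using chord_sup_oscillation[of x] assms by auto
  ultimately show ?thesis using order_trans[OF _ omega1_le_chord_sup[OF assms]] by simp
qed (use assms chord_sup_oscillation in auto)

lemma end_modulus_le_one:
  assumes "x \<in> {0..1}" shows "modulus x \<le> 1"
proof (rule end_modulus_cases)
  assume "modulus = chord_sup {0..1} \<omega>1"
  then show ?thesis
    using chord_sup_omega1_affine[of 1 0 x] omega1_le_one assms by simp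
qed (use assms chord_sup_oscillation in auto)

lemma concave_on_end_modulus: "concave_on {0..1} modulus"
proof (rule end_modulus_cases)
  assume "modulus = chord_sup {0..1} \<omega>1"
  then show ?thesis
    using concave_on_chord_sup[of "{0..1}" \<omega>1 1] omega1_le_one by simp
next
  assume "modulus = \<omega>"
  moreover have "concave_on {0..} \<omega>"
    using oscillation_le_one by (intro concave_on_chord_sup[of _ _ 1]) auto
  ultimately show ?thesis
    unfolding concave_on_def by (auto intro: convex_on_subset)
qed

lemma end_modulus_one: "modulus 1 = 1"
proof (rule end_modulus_cases)
  assume "modulus = chord_sup {0..1} \<omega>1"
  then show ?thesis
    using omega1_le_chord_sup[of 1] end_modulus_le_one[of 1] by simp
qed simp

lemma end_modulus_ge:
  assumes "x \<in> {0..1}" shows "x \<le> modulus x"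
proof -
  have "0 \<le> modulus 0"
    using oscillation_le_end_modulus[of 0] oscillation_nonneg[of 0] by simp
  then show ?thesis
    by (rule ge_self_of_concave_on[OF concave_on_end_modulus _ end_modulus_one assms])
qed

text \<open>The affine bound on \<open>\<rho>\<close> survives the chord suprema. As
  \<open>e\<close> is arbitrary, the modulus tends to 0 at 0.\<close>

lemma end_modulus_affine_bound:
  assumes "0 < e"
  obtains C where "0 \<le> C" "\<And>x. x \<in> {0..1} \<Longrightarrow> modulus x \<le> e + C * x"
proof -
  obtain C where C: "0 \<le> C" "\<And>x. 0 \<le> x \<Longrightarrow> \<rho> x \<le> e + C * x"
    using oscillation_affine_bound[OF assms] by blast
  have om: "\<omega> x \<le> e + C * x" if "0 \<le> x" for x
    using chord_sup_oscillation_affine[OF C(2) that] .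
  \<comment> \<open>The extra slope 1 keeps the line above the raised value of
    \<open>\<omega>1\<close> at 1.\<close>
  have "modulus x \<le> e + (C + 1) * x" if x: "x \<in> {0..1}" for x
  proof (rule end_modulus_cases)
    assume "modulus = chord_sup {0..1} \<omega>1"
    moreover have "\<omega>1 z \<le> e + (C + 1) * z" if "z \<in> {0..1}" for z
      using that om[of z] assms C(1) by (auto simp: algebra_simps)
    ultimately show ?thesis
      using chord_sup_omega1_affine[OF _ x] by metis
  next
    assume "modulus = \<omega>"
    then show ?thesis using om[of x] x by (auto simp: algebra_simps)
  qed
  then show thesis using that[of "C + 1"] C by simp
qed

lemma continuous_on_end_modulus: "continuous_on {0<..1} modulus"
  by (rule continuous_on_concave_modulus[OF concave_on_end_modulus end_modulus_ge end_modulus_le_one])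

section \<open>The time change \<open>\<phi>\<close>\<close>

lemma end_modulus_exp:
  assumes "0 \<le> t"
  shows "0 < modulus (exp (- t))" "modulus (exp (- t)) = exp (- \<phi> t)" "0 \<le> \<phi> t"
proof -
  have 1: "exp (- t) \<in> {0..1}" using assms by simp
  then show pos: "0 < modulus (exp (- t))"
    using end_modulus_ge[of "exp (- t)"] exp_gt_zero[of "- t"] by linarith
  then show "modulus (exp (- t)) = exp (- \<phi> t)" by (simp add: \<phi>_def)
  show "0 \<le> \<phi> t" using end_modulus_le_one[OF 1] pos by (simp add: \<phi>_def)
qed

lemma phi_zero: "\<phi> 0 = 0"
  by (simp add: \<phi>_def end_modulus_one)

lemma continuous_on_phi: "continuous_on {0..} \<phi>"
proof -
  have "continuous_on {0..} (\<lambda>t. modulus (exp (- t)))"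
    by (rule continuous_on_compose2[OF continuous_on_end_modulus]) (auto intro!: continuous_intros)
  then have "continuous_on {0..} (\<lambda>t. - ln (modulus (exp (- t))))"
    using end_modulus_exp(1) by (intro continuous_intros) force+
  then show ?thesis by (simp add: \<phi>_def[abs_def])
qed

text \<open>If \<open>\<phi> t \<le> R\<close>, the modulus at \<open>exp (- t)\<close> is at least
  \<open>exp (- R)\<close>. An affine bound with constant term \<open>exp (- R) / 2\<close> leaves
  the other half to \<open>C * exp (- t)\<close>, which limits \<open>t\<close>.\<close>

lemma phi_unbounded:
  obtains t0 where "\<And>t. 0 \<le> t \<Longrightarrow> \<phi> t \<le> R \<Longrightarrow> t \<le> t0"
proof -
  obtain C where C: "0 \<le> C" "\<And>x. x \<in> {0..1} \<Longrightarrow> modulus x \<le> exp (- R) / 2 + C * x"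
    using end_modulus_affine_bound[of "exp (- R) / 2"] by auto
  \<comment> \<open>With \<open>C + 1\<close> the argument of \<open>ln\<close> is positive even for
    \<open>C = 0\<close>.\<close>
  have "t \<le> ln (2 * (C + 1) / exp (- R))" if t: "0 \<le> t" "\<phi> t \<le> R" for t
  proof -
    have "exp (- R) \<le> exp (- \<phi> t)" using t by simp
    also have "\<dots> \<le> exp (- R) / 2 + C * exp (- t)"
      using C(2)[of "exp (- t)"] end_modulus_exp(2)[OF t(1)] t by simp
    finally have "exp (- R) \<le> 2 * C * exp (- t)" by simp
    also have "\<dots> \<le> 2 * (C + 1) * exp (- t)" by simp
    finally have "exp (- R) * exp t \<le> 2 * (C + 1) * (exp (- t) * exp t)" by (simp add: exp_minus field_simps)
    then have "exp t \<le> 2 * (C + 1) / exp (- R)"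
      by (simp add: exp_minus field_simps)
    then show ?thesis using C(1) by (subst ln_ge_iff) auto
  qed
  then show thesis by (rule that)
qed

text \<open>Agreement at \<open>t\<close> means end distance at most \<open>exp (- t)\<close>. The
  modulus turns this into at most \<open>exp (- \<phi> t)\<close> for the images, which means
  agreement at \<open>\<phi> t\<close>.\<close>

lemma image_branches_agree:
  assumes F: "F \<in> end_space T v" and G: "G \<in> end_space T v" and t: "0 \<le> t" and eq: "F t = G t"
  shows "f F (\<phi> t) = f G (\<phi> t)"
proof -
  have "end_dist F G \<le> exp (- t)" using end_dist_le_exp_iff[OF T v F G t] eq by simp
  then have "end_dist (f F) (f G) \<le> \<rho> (exp (- t))" by (rule end_dist_le_oscillation[OF F G])
  also have "\<dots> \<le> exp (- \<phi> t)"
    using oscillation_le_end_modulus[of "exp (- t)"] end_modulus_exp(2)[OF t] t by simp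
  finally show ?thesis
    using end_dist_le_exp_iff[OF T' w maps_ends[OF F] maps_ends[OF G] end_modulus_exp(3)[OF t]]
    by simp
qed

text \<open>The branch selected by \<open>SOME\<close> agrees with \<open>F\<close> at
  \<open>t\<close>, so the choice does not affect the value.\<close>

lemma induced_map_eq:
  assumes F: "F \<in> end_space T v" and t: "0 \<le> t"
  shows "induced_map T v w f (F t) = f F (\<phi> t)"
proof -
  have d: "dist v (F t) = t"
    using end_space_embedding(2)[OF F, of 0 t] end_space_embedding(3)[OF F order.refl order.refl] t
    by simp
  define G where "G = (SOME G. G \<in> end_space T v \<and> G t = F t)"
  have "G \<in> end_space T v \<and> G t = F t"
    unfolding G_def by (rule someI[of _ F]) (simp add: F)
  then have "f G (\<phi> t) = f F (\<phi> t)"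
    using image_branches_agree[of G F t] F t by blast
  then show ?thesis
    using ends by (simp add: induced_map_def d G_def \<phi>_def Let_def)
qed

text \<open>The image path goes through the image of \<open>F m = G m\<close>; each leg stays on one
  image branch, where distance is the difference of times.\<close>

lemma dist_induced_map_le:
  assumes F: "F \<in> end_space T v" and G: "G \<in> end_space T v" and t: "0 \<le> t" and s: "0 \<le> s"
  obtains m where "0 \<le> m" "\<bar>m - t\<bar> \<le> dist (F t) (G s)" "\<bar>s - t\<bar> \<le> dist (F t) (G s)"
    "dist (induced_map T v w f (F t)) (induced_map T v w f (G s)) \<le> \<bar>\<phi> t - \<phi> m\<bar> + \<bar>\<phi> m - \<phi> s\<bar>"
proof -
  obtain m where m: "0 \<le> m" "m \<le> t" "m \<le> s" "F m = G m"
    "t - m \<le> dist (F t) (G s)" "s - m \<le> dist (F t) (G s)"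
    by (rule branches_common_point[OF T v F G t s])
  have "dist (f F (\<phi> t)) (f G (\<phi> s)) \<le>
      dist (f F (\<phi> t)) (f F (\<phi> m)) + dist (f G (\<phi> m)) (f G (\<phi> s))"
    using image_branches_agree[OF F G m(1,4)] by (metis dist_triangle)
  also have "\<dots> = \<bar>\<phi> t - \<phi> m\<bar> + \<bar>\<phi> m - \<phi> s\<bar>"
    using end_modulus_exp(3) t s m(1) end_space_embedding(2)[OF maps_ends[OF F]]
      end_space_embedding(2)[OF maps_ends[OF G]] by presburger
  finally show thesis
    using that[of m] m induced_map_eq F G t s by auto
qed

lemma metrically_proper_induced_map:
  assumes branch: "\<And>x. x \<in> T \<Longrightarrow> \<exists>F\<in>end_space T v. F (dist v x) = x"
  shows "metrically_proper T v T' w (induced_map T v w f)"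
proof -
  let ?h = "induced_map T v w f"
  \<comment> \<open>The image of \<open>x\<close> lies at time \<open>\<phi> (dist v x)\<close> on a
    branch from \<open>w\<close>. The radius gives both the image of the root and
    properness.\<close>
  have maps: "?h \<in> T \<rightarrow> T'" and radius: "\<And>x. x \<in> T \<Longrightarrow> dist w (?h x) = \<phi> (dist v x)"
  proof -
    have *: "?h x \<in> T' \<and> dist w (?h x) = \<phi> (dist v x)" if "x \<in> T" for x
    proof -
      obtain F where F: "F \<in> end_space T v" "F (dist v x) = x" using branch \<open>x \<in> T\<close> by blast
      have "?h x = f F (\<phi> (dist v x))"
        using induced_map_eq[OF F(1), of "dist v x"] F(2) by simp
      then show ?thesis
        using end_space_embedding[OF maps_ends[OF F(1)], of 0 "\<phi> (dist v x)"]
          end_space_embedding(1)[OF maps_ends[OF F(1)], of "\<phi> (dist v x)"]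
          end_modulus_exp(3)[of "dist v x"] by simp
    qed
    show "?h \<in> T \<rightarrow> T'" "\<And>x. x \<in> T \<Longrightarrow> dist w (?h x) = \<phi> (dist v x)" using * by auto
  qed
  have root: "?h v = w" using radius[OF v] phi_zero by simp
  have cont: "continuous_on T ?h"
    unfolding continuous_on_iff
  proof (intro ballI allI impI)
    fix x and e :: real assume x: "x \<in> T" and e: "0 < e"
    define t where "t = dist v x"
    have t: "0 \<le> t" by (simp add: t_def)
    \<comment> \<open>Continuity of \<open>\<phi>\<close> is used only at \<open>t\<close>: the term
      \<open>\<bar>\<phi> m - \<phi> s\<bar>\<close> is split at \<open>\<phi> t\<close>, making
      three parts.\<close>
    obtain d where d: "0 < d" "\<And>u. 0 \<le> u \<Longrightarrow> \<bar>u - t\<bar> < d \<Longrightarrow> \<bar>\<phi> u - \<phi> t\<bar> < e / 3"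
      using continuous_on_phi t e unfolding continuous_on_iff dist_real_def
      by (metis atLeast_iff divide_pos_pos zero_less_numeral)
    have "dist (?h y) (?h x) < e" if y: "y \<in> T" "dist y x < d" for y
    proof -
      define s where "s = dist v y"
      obtain F where F: "F \<in> end_space T v" "F t = x" using branch x t_def by blast
      obtain G where G: "G \<in> end_space T v" "G s = y" using branch y s_def by blast
      have s: "0 \<le> s" by (simp add: s_def)
      obtain m where m: "0 \<le> m" "\<bar>m - t\<bar> \<le> dist x y" "\<bar>s - t\<bar> \<le> dist x y"
        "dist (?h x) (?h y) \<le> \<bar>\<phi> t - \<phi> m\<bar> + \<bar>\<phi> m - \<phi> s\<bar>"
        using dist_induced_map_le[OF F(1) G(1) t s] unfolding F(2) G(2) by blast
      have "\<bar>\<phi> m - \<phi> t\<bar> < e / 3" "\<bar>\<phi> s - \<phi> t\<bar> < e / 3"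
        using d(2) m y s by (auto simp: dist_commute)
      then show ?thesis using m(4) unfolding dist_commute[of "?h y"] by linarith
    qed
    then show "\<exists>d>0. \<forall>y\<in>T. dist y x < d \<longrightarrow> dist (?h y) (?h x) < e" using d(1) by blast
  qed
  have "bounded (T \<inter> ?h -` A)" if "bounded A" for A
  proof -
    obtain R where R: "\<And>a. a \<in> A \<Longrightarrow> dist w a \<le> R"
      using \<open>bounded A\<close> bounded_any_center[of A w] by auto
    obtain t0 where t0: "\<And>t. 0 \<le> t \<Longrightarrow> \<phi> t \<le> R \<Longrightarrow> t \<le> t0" using phi_unbounded by blast
    \<comment> \<open>A bound on the distance of \<open>?h x\<close> from \<open>w\<close> bounds
      \<open>\<phi> (dist v x)\<close>, hence \<open>dist v x\<close>.\<close>
    have "dist v x \<le> t0" if "x \<in> T \<inter> ?h -` A" for x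
      using that R[of "?h x"] radius[of x] by (intro t0) auto
    then show ?thesis unfolding bounded_def by blast
  qed
  then show ?thesis
    using maps cont root by (simp add: metrically_proper_def)
qed

end

theorem proposition7p1p12:
  fixes T :: "'a::metric_space set" and v :: 'a
    and T' :: "'b::metric_space set" and w :: 'b
    and f :: "(real \<Rightarrow> 'a) \<Rightarrow> (real \<Rightarrow> 'b)"
  assumes "rooted_R_tree T v" and "geodesically_complete T v"
    and "rooted_R_tree T' w" and "geodesically_complete T' w"
    and "uniformly_continuous_map (end_metric T v) (end_metric T' w) f"
  shows "metrically_proper T v T' w (induced_map T v w f)"
proof (cases "end_space T v = {}")
  case True
  have T: "R_tree T" "v \<in> T" and w: "w \<in> T'"
    using assms by (auto simp: rooted_R_tree_def)
  have "T = {v}"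
    \<comment> \<open>Any point other than \<open>v\<close> would lie on a branch.\<close>
    using geodesically_complete_branch[OF T assms(2)] True T(2) by blast
  moreover have "induced_map T v w f = (\<lambda>x. w)"
    using True by (auto simp: induced_map_def)
  moreover have "bounded ({v} \<inter> B)" for B
    by (rule bounded_subset[of "{v}"]) auto
  ultimately show ?thesis
    using w by (simp add: metrically_proper_def)
next
  case False
  interpret end_space_map T v T' w f
    using assms False by unfold_locales (auto simp: rooted_R_tree_def)
  show ?thesis
  proof (rule metrically_proper_induced_map)
    fix x assume x: "x \<in> T"
    show "\<exists>F\<in>end_space T v. F (dist v x) = x"
    proof (cases "x = v")
      case True
      \<comment> \<open>Every branch passes through \<open>v\<close> at time 0, and some branch
        exists.\<close>
      then show ?thesis using False by (auto simp: end_space_def)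
    next
      case False
      then show ?thesis using geodesically_complete_branch[OF T v assms(2) x] by blast
    qed
  qed
qed

end
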